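(* Let $(g_h(t),\kappa_h(t))$, $t\in[0,T]$, be a solution of Scheme P or of Scheme $\Pi$ (defined in the context). Then the discrete Gauss–Bonnet identity $$\int_{M_h}\kappa_h(t)\,\omega_{g_h(t)}=\int_{M_h}\kappa_h(0)\,\omega_{g_h(0)},\qquad\forall t\in[0,T],$$ holds. Moreover, for solutions of Scheme $\Pi$, the area is conserved: $$\int_{M_h}\omega_{g_h(t)}=\int_{M_h}\omega_{g_h(0)},\qquad\forall t\in[0,T].$$
   Context: $\mathcal M$ is a smooth, oriented, two-dimensional manifold without boundary embedded in $\mathbb R^3$ with outer unit normal $n$, carrying a smooth evolving metric $g(t)$ and curvature $\kappa(t)$ solving the normalized Ricci flow $\partial_tg=2(\bar\kappa-\kappa)g$, $\bar\kappa$ the average of the initial Gaussian curvature. $M_h$ is a piecewise flat, quasi-uniform triangular surface (finitely many flat triangles, vertices on $\mathcal M$) in a small tubular neighbourhood of $\mathcal M$, with bijection $a:M_h\to\mathcal M$ satisfying $p-a(p)=\pm|p-a(p)|n(a(p))$; $\mathcal T_h$, $\mathcal E_h$ are its triangles and edges. For functions $f^{(l)}=f\circ a^{-1}$; for $(0,2)$-tensors $\sigma$ on $\mathcal M$, $\sigma^{(-l)}=a^*\sigma$. On each $K\in\mathcal T_h$ a symmetric $(0,2)$-tensor field is identified with its symmetric $2\times2$ matrix in a constant Euclidean-orthonormal tangent frame, and $\nabla u=(\partial_1u,\partial_2u)^\top$ in this frame. **Spaces.** $\Sigma$: tensor fields $\sigma$ on $M_h$ with $\sigma|_K$ symmetric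 $(0,2)$ with $H^1(K)$ components for each $K$, whose pullbacks (tangential-tangential components) to any common edge of two triangles agree. $\Sigma_+$: pointwise positive definite elements. $P_rS_2^0(K)$: symmetric $(0,2)$-tensor fields on $K$ with polynomial components of degree $\le r$ (zero if $r=-1$). For integers $r\ge0,q\ge1$: $\Sigma_h=\{\sigma\in\Sigma:\sigma|_K\in P_rS_2^0(K)\ \forall K\}$, $V_h=\{v\in C(M_h):v|_K\in P_q(K)\ \forall K\}$. For $g\in\Sigma_+$: $\omega_g=\sqrt{\det g}\,dx$, $(u,v)_{g,M_h}=\int_{M_h}uv\sqrt{\det g}\,dx$, $(\nabla_gu,\nabla_gv)_{g,M_h}=\int_{M_h}g^{-1}\nabla u\cdot\nabla v\sqrt{\det g}\,dx$, $(\sigma,\rho)_{g,K}=\int_K\mathrm{Tr}(g^{-1}\sigma g^{-1}\rho)\sqrt{\det g}\,dx$, $(\sigma,\rho)_{g,M_h}=\sum_K(\sigma,\rho)_{g,K}$; on an edge $e$ with Euclidean unit tangent $\tau$: $ds_g=\sqrt{g(\tau,\tau)}ds$, $\tau_g=\tau/\sqrt{g(\tau,\tau)}$, $\langle u,v\rangle_{g,e}=\int_euv\,ds_g$. **Projections.** For $g\in\Sigma_+$, $P_g:\Sigma\to\Sigma_h$ is defined by $\langle P_g\sigma(\tau_g,\tau_g),v\rangle_{g,e}=\langle\sigma(\tau_g,\tau_g),v\rangle_{g,e}$ for all $v\in P_r(e)$, $e\in\mathcal E_h$, and $(P_g\sigma,\rho)_{g,K}=(\sigma,\rho)_{g,K}$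 for all $\rho\in P_{r-1}S_2^0(K)$, $K\in\mathcal T_h$; $P_h$ is this projection for the induced Euclidean metric. $\Pi_g:\Sigma\to\Sigma_h$ is defined by $(\Pi_g\sigma,\rho)_{g,M_h}=(\sigma,\rho)_{g,M_h}$ for all $\rho\in\Sigma_h$. With $g_h^*=P_hg^{(-l)}$, $R_hu\in V_h$ is the Ritz projection: $(\nabla_{g_h^*}R_hu,\nabla_{g_h^*}\phi_h)_{g_h^*,M_h}=\int_{\mathcal M}\langle\nabla_gu,\nabla_g\phi_h^{(l)}\rangle_g\omega_g$ for all $\phi_h\in V_h$, and $\int_{\mathcal M}(R_hu)^{(l)}=\int_{\mathcal M}u$ (integrals for the Euclidean surface measure). **Scheme P.** Find $g_h(t)\in\Sigma_h$ and $\kappa_h(t)\in V_h$ with $\partial_tg_h+2P_{g_h}((\kappa_h-\bar\kappa_h)g_h)=0$ and $\frac{d}{dt}(\kappa_h,\phi_h)_{g_h,M_h}+(\nabla_{g_h}\kappa_h,\nabla_{g_h}\phi_h)_{g_h,M_h}=0$ for all time-independent $\phi_h\in V_h$. **Scheme $\Pi$.** The same with $P_{g_h}$ replaced by $\Pi_{g_h}$ in the first equation. In both, $g_h(0)=P_hg^{(-l)}(0)$, $\kappa_h(0)=R_h\kappa(0)$, and $\bar\kappa_h=\int_{M_h}\kappa_h(0)\omega_{g_h(0)}/\int_{M_h}\omega_{g_h(0)}$. A solution is understood to have $g_h(t)$ positive definite, so that all the metric-dependent objects are defined. *)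

theory Defs
  imports "HOL-Analysis.Analysis" "HOL-Computational_Algebra.Polynomial"
begin

section \<open>Smooth maps\<close>

primrec Ck_on :: "nat \<Rightarrow> ('a::euclidean_space \<Rightarrow> 'b::real_normed_vector) \<Rightarrow> 'a set \<Rightarrow> bool" where
  "Ck_on 0 f U \<longleftrightarrow> continuous_on U f"
| "Ck_on (Suc k) f U \<longleftrightarrow> (\<forall>x\<in>U. f differentiable at x) \<and>
     (\<forall>b\<in>Basis. Ck_on k (\<lambda>x. frechet_derivative f (at x) b) U)"

text \<open>Smoothness on an arbitrary set: local existence of smooth extensions.\<close>

definition smooth_on :: "('a::euclidean_space \<Rightarrow> 'b::real_normed_vector) \<Rightarrow> 'a set \<Rightarrow> bool" where
  "smooth_on f S \<longleftrightarrow>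
     (\<forall>x\<in>S. \<exists>U F. open U \<and> x \<in> U \<and> (\<forall>k. Ck_on k F U) \<and> (\<forall>y\<in>U \<inter> S. F y = f y))"

definition partial :: "'n \<Rightarrow> (real^'n \<Rightarrow> 'b::real_normed_vector) \<Rightarrow> real^'n \<Rightarrow> 'b" where
  "partial i f x = frechet_derivative f (at x) (axis i 1)"

section \<open>Embedded surfaces\<close>

definition chart :: "(real^3) set \<Rightarrow> (real^2) set \<Rightarrow> (real^2 \<Rightarrow> real^3) \<Rightarrow> bool" where
  "chart M U \<phi> \<longleftrightarrow> open U \<and> smooth_on \<phi> U \<and> openin (top_of_set M) (\<phi> ` U) \<and>
     (\<exists>\<psi>. homeomorphism U (\<phi> ` U) \<phi> \<psi>) \<and> (\<forall>u\<in>U. inj (frechet_derivative \<phi> (at u)))"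

definition smooth_surface :: "(real^3) set \<Rightarrow> bool" where
  "smooth_surface M \<longleftrightarrow> (\<forall>x\<in>M. \<exists>U \<phi>. chart M U \<phi> \<and> x \<in> \<phi> ` U)"

definition tangent_space :: "(real^3) set \<Rightarrow> real^3 \<Rightarrow> (real^3) set" where
  "tangent_space M x =
     {v. \<exists>U \<phi> u. chart M U \<phi> \<and> u \<in> U \<and> \<phi> u = x \<and> v \<in> range (frechet_derivative \<phi> (at u))}"

text \<open>The existence of the smooth unit normal is the orientation of the surface. It is outer with
  respect to the connected component of the surface through the given point.\<close>

definition outer_unit_normal :: "(real^3) set \<Rightarrow> (real^3 \<Rightarrow> real^3) \<Rightarrow> bool" where
  "outer_unit_normal M n \<longleftrightarrow> smooth_on n M \<and>
     (\<forall>x\<in>M. norm (n x) = 1 \<and> (\<forall>v\<in>tangent_space M x. n x \<bullet> v = 0) \<and>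
        (\<exists>\<epsilon>>0. \<forall>s\<in>{0<..<\<epsilon>}. x + s *\<^sub>R n x \<in> outside (connected_component_set M x) \<and>
                            x - s *\<^sub>R n x \<in> inside (connected_component_set M x)))"

definition tubular_neighbourhood ::
  "(real^3) set \<Rightarrow> (real^3 \<Rightarrow> real^3) \<Rightarrow> real \<Rightarrow> (real^3) set \<Rightarrow> bool" where
  "tubular_neighbourhood M n \<delta> N \<longleftrightarrow> 0 < \<delta> \<and> open N \<and>
     (\<exists>\<psi>. homeomorphism (M \<times> {-\<delta><..<\<delta>}) N (\<lambda>(x, s). x + s *\<^sub>R n x) \<psi> \<and> smooth_on \<psi> N)"

section \<open>Riemannian metrics on surfaces\<close>

text \<open>A (0,2)-tensor field on a surface is a map \<open>g\<close> where only the values \<open>g x v w\<close> with \<open>x\<close> on the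
  surface and \<open>v\<close>, \<open>w\<close> tangent at \<open>x\<close> are meaningful.\<close>

type_synonym surf_tensor = "real^3 \<Rightarrow> real^3 \<Rightarrow> real^3 \<Rightarrow> real"

definition euclidean_metric :: surf_tensor where
  "euclidean_metric x v w = v \<bullet> w"

definition riemannian_metric :: "(real^3) set \<Rightarrow> surf_tensor \<Rightarrow> bool" where
  "riemannian_metric M g \<longleftrightarrow>
     (\<forall>x\<in>M. \<forall>u\<in>tangent_space M x. \<forall>v\<in>tangent_space M x.
        g x u v = g x v u \<and> (u \<noteq> 0 \<longrightarrow> g x u u > 0) \<and>
        (\<forall>w\<in>tangent_space M x. \<forall>c. g x (u + c *\<^sub>R v) w = g x u w + c * g x v w))"

definition metric_coeffs :: "surf_tensor \<Rightarrow> (real^2 \<Rightarrow> real^3) \<Rightarrow> real^2 \<Rightarrow> real^2^2" where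
  "metric_coeffs g \<phi> u = (\<chi> i j. g (\<phi> u) (partial i \<phi> u) (partial j \<phi> u))"

definition smooth_evolving_metric ::
  "real \<Rightarrow> (real^3) set \<Rightarrow> (real \<Rightarrow> surf_tensor) \<Rightarrow> bool" where
  "smooth_evolving_metric T M g \<longleftrightarrow> (\<forall>t\<in>{0..T}. riemannian_metric M (g t)) \<and>
     (\<forall>U \<phi>. chart M U \<phi> \<longrightarrow> smooth_on (\<lambda>(t, u). metric_coeffs (g t) \<phi> u) ({0..T} \<times> U))"

definition christoffel :: "(real^2 \<Rightarrow> real^2^2) \<Rightarrow> 2 \<Rightarrow> 2 \<Rightarrow> 2 \<Rightarrow> real^2 \<Rightarrow> real" where
  "christoffel G l i j u = 1/2 * (\<Sum>k\<in>UNIV. matrix_inv (G u) $ l $ k *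
     (partial i (\<lambda>y. G y $ j $ k) u + partial j (\<lambda>y. G y $ i $ k) u - partial k (\<lambda>y. G y $ i $ j) u))"

text \<open>\<open>riemann G l i j k\<close> is the component \<open>l\<close> of \<open>R(\<partial>\<^sub>i, \<partial>\<^sub>j) \<partial>\<^sub>k\<close>, with
  \<open>R(X, Y) = \<nabla>\<^sub>X \<nabla>\<^sub>Y - \<nabla>\<^sub>Y \<nabla>\<^sub>X - \<nabla>\<^bsub>[X, Y]\<^esub>\<close>. The Gaussian curvature is
  \<open>g(R(\<partial>\<^sub>1, \<partial>\<^sub>2) \<partial>\<^sub>2, \<partial>\<^sub>1) / det g\<close>, which is 1 on the unit sphere.\<close>

definition riemann :: "(real^2 \<Rightarrow> real^2^2) \<Rightarrow> 2 \<Rightarrow> 2 \<Rightarrow> 2 \<Rightarrow> 2 \<Rightarrow> real^2 \<Rightarrow> real" where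
  "riemann G l i j k u =
     partial i (christoffel G l j k) u - partial j (christoffel G l i k) u +
     (\<Sum>p\<in>UNIV. christoffel G l i p u * christoffel G p j k u -
               christoffel G l j p u * christoffel G p i k u)"

definition gauss_curvature :: "(real^2 \<Rightarrow> real^2^2) \<Rightarrow> real^2 \<Rightarrow> real" where
  "gauss_curvature G u = (\<Sum>l\<in>UNIV. G u $ l $ 1 * riemann G l 1 2 2 u) / det (G u)"

definition is_gauss_curvature :: "(real^3) set \<Rightarrow> surf_tensor \<Rightarrow> (real^3 \<Rightarrow> real) \<Rightarrow> bool" where
  "is_gauss_curvature M g \<kappa> \<longleftrightarrow>
     (\<forall>U \<phi>. chart M U \<phi> \<longrightarrow> (\<forall>u\<in>U. \<kappa> (\<phi> u) = gauss_curvature (metric_coeffs g \<phi>) u))"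

text \<open>The area measure is the unique Borel measure on the surface that has density \<open>sqrt (det G)\<close> in
  every chart. It is completed so that functions that are defined only almost everywhere (gradients
  of lifted piecewise polynomials) may be integrated.\<close>

definition area_measure :: "(real^3) set \<Rightarrow> surf_tensor \<Rightarrow> (real^3) measure" where
  "area_measure M g = completion (THE \<mu>. sets \<mu> = sets (restrict_space borel M) \<and>
     (\<forall>U \<phi>. chart M U \<phi> \<longrightarrow> (\<forall>A\<in>sets \<mu>. A \<subseteq> \<phi> ` U \<longrightarrow>
        emeasure \<mu> A = (\<integral>\<^sup>+ u\<in>{u\<in>U. \<phi> u \<in> A}. ennreal (sqrt (det (metric_coeffs g \<phi> u))) \<partial>lborel))))"

definition surf_integral :: "(real^3) set \<Rightarrow> surf_tensor \<Rightarrow> (real^3 \<Rightarrow> real) \<Rightarrow> real" where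
  "surf_integral M g f = (LINT x|area_measure M g. f x)"

text \<open>The derivative within the surface is determined by \<open>u\<close> on tangent vectors only, so the
  gradient is well defined.\<close>

definition surf_gradient ::
  "(real^3) set \<Rightarrow> surf_tensor \<Rightarrow> (real^3 \<Rightarrow> real) \<Rightarrow> real^3 \<Rightarrow> real^3" where
  "surf_gradient M g u x = (THE z. z \<in> tangent_space M x \<and>
     (\<forall>v\<in>tangent_space M x. g x z v = frechet_derivative u (at x within M) v))"

definition normalized_ricci_flow ::
  "real \<Rightarrow> (real^3) set \<Rightarrow> (real \<Rightarrow> surf_tensor) \<Rightarrow> (real \<Rightarrow> real^3 \<Rightarrow> real) \<Rightarrow> bool" where
  "normalized_ricci_flow T M g \<kappa> \<longleftrightarrow> smooth_evolving_metric T M g \<and>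
     (\<forall>t\<in>{0..T}. is_gauss_curvature M (g t) (\<kappa> t)) \<and>
     (let \<kappa>bar = surf_integral M (g 0) (\<kappa> 0) / surf_integral M (g 0) (\<lambda>_. 1) in
      \<forall>t\<in>{0..T}. \<forall>x\<in>M. \<forall>v\<in>tangent_space M x. \<forall>w\<in>tangent_space M x.
        ((\<lambda>s. g s x v w) has_real_derivative 2 * (\<kappa>bar - \<kappa> t x) * g t x v w) (at t within {0..T}))"

section \<open>Piecewise flat triangular surfaces\<close>

text \<open>A mesh carries the choice of a constant tangent frame on each triangle and of a unit tangent
  on each edge.\<close>

record mesh =
  triangles :: "(real^3) set set"
  frame :: "(real^3) set \<Rightarrow> 2 \<Rightarrow> real^3"
  tangent :: "(real^3) set \<Rightarrow> real^3"

definition edges :: "mesh \<Rightarrow> (real^3) set set" where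
  "edges m = {e. \<exists>K\<in>triangles m. e face_of K \<and> 1 simplex e}"

definition carrier :: "mesh \<Rightarrow> (real^3) set" where
  "carrier m = \<Union>(triangles m)"

definition triangular_mesh :: "mesh \<Rightarrow> bool" where
  "triangular_mesh m \<longleftrightarrow> triangulation (triangles m) \<and>
     (\<forall>K\<in>triangles m. 2 simplex K \<and>
        (\<forall>i. frame m K i \<in> span {y - x | x y. x \<in> K \<and> y \<in> K}) \<and>
        (\<forall>i j. frame m K i \<bullet> frame m K j = (if i = j then 1 else 0))) \<and>
     (\<forall>e\<in>edges m. tangent m e \<in> span {y - x | x y. x \<in> e \<and> y \<in> e} \<and> norm (tangent m e) = 1)"

definition inradius :: "(real^3) set \<Rightarrow> real" where
  "inradius K = Sup {\<rho>. \<exists>x\<in>K. cball x \<rho> \<inter> affine hull K \<subseteq> K}"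

definition quasi_uniform :: "real \<Rightarrow> mesh \<Rightarrow> bool" where
  "quasi_uniform C m \<longleftrightarrow> (\<forall>K\<in>triangles m. \<forall>K'\<in>triangles m. diameter K \<le> C * inradius K')"

definition approximates ::
  "mesh \<Rightarrow> (real^3) set \<Rightarrow> (real^3 \<Rightarrow> real^3) \<Rightarrow> (real^3 \<Rightarrow> real^3) \<Rightarrow> bool" where
  "approximates m M n a \<longleftrightarrow>
     (\<forall>K\<in>triangles m. \<forall>v. v extreme_point_of K \<longrightarrow> v \<in> M) \<and>
     bij_betw a (carrier m) M \<and>
     (\<exists>\<delta> N. tubular_neighbourhood M n \<delta> N \<and> carrier m \<subseteq> N \<and>
        (\<forall>p\<in>carrier m. norm (p - a p) < \<delta> \<and>
           (p - a p = norm (p - a p) *\<^sub>R n (a p) \<or> p - a p = - (norm (p - a p) *\<^sub>R n (a p)))))"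

definition base :: "(real^3) set \<Rightarrow> real^3" where
  "base S = (SOME x. x \<in> S)"

text \<open>Cartesian coordinates on a triangle (\<open>loc\<close> is inverse to \<open>emb\<close> there) and arc length on an edge.\<close>

definition emb :: "mesh \<Rightarrow> (real^3) set \<Rightarrow> real^2 \<Rightarrow> real^3" where
  "emb m K \<xi> = base K + (\<Sum>i\<in>UNIV. \<xi> $ i *\<^sub>R frame m K i)"

definition loc :: "mesh \<Rightarrow> (real^3) set \<Rightarrow> real^3 \<Rightarrow> real^2" where
  "loc m K x = (\<chi> i. (x - base K) \<bullet> frame m K i)"

definition tri_dom :: "mesh \<Rightarrow> (real^3) set \<Rightarrow> (real^2) set" where
  "tri_dom m K = {\<xi>. emb m K \<xi> \<in> K}"

definition eemb :: "mesh \<Rightarrow> (real^3) set \<Rightarrow> real \<Rightarrow> real^3" where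
  "eemb m e s = base e + s *\<^sub>R tangent m e"

definition edge_dom :: "mesh \<Rightarrow> (real^3) set \<Rightarrow> real set" where
  "edge_dom m e = {s. eemb m e s \<in> e}"

definition tri_integral :: "mesh \<Rightarrow> (real^3) set \<Rightarrow> (real^3 \<Rightarrow> real) \<Rightarrow> real" where
  "tri_integral m K f = (LINT \<xi>|lebesgue_on (tri_dom m K). f (emb m K \<xi>))"

definition edge_integral :: "mesh \<Rightarrow> (real^3) set \<Rightarrow> (real^3 \<Rightarrow> real) \<Rightarrow> real" where
  "edge_integral m e f = (LINT s|lebesgue_on (edge_dom m e). f (eemb m e s))"

section \<open>Finite element spaces\<close>

text \<open>Piecewise tensor fields are given on each triangle by the matrix in the frame of that triangle;
  they may take different values on a common edge.\<close>

type_synonym mesh_tensor = "(real^3) set \<Rightarrow> real^3 \<Rightarrow> real^2^2"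

text \<open>The degree is an integer since \<open>P\<^bsub>r-1\<^esub>\<close> with \<open>r = 0\<close> is the zero space.\<close>

definition poly_on_tri :: "mesh \<Rightarrow> (real^3) set \<Rightarrow> int \<Rightarrow> (real^3 \<Rightarrow> real) \<Rightarrow> bool" where
  "poly_on_tri m K d f \<longleftrightarrow> (\<exists>c. \<forall>x\<in>K.
     f x = (\<Sum>(i, j)\<in>{(i, j). int (i + j) \<le> d}. c i j * (loc m K x $ 1) ^ i * (loc m K x $ 2) ^ j))"

definition poly_tensor_on_tri :: "mesh \<Rightarrow> (real^3) set \<Rightarrow> int \<Rightarrow> (real^3 \<Rightarrow> real^2^2) \<Rightarrow> bool" where
  "poly_tensor_on_tri m K d \<sigma> \<longleftrightarrow>
     (\<forall>x\<in>K. transpose (\<sigma> x) = \<sigma> x) \<and> (\<forall>i j. poly_on_tri m K d (\<lambda>x. \<sigma> x $ i $ j))"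

text \<open>\<open>x \<bullet> tangent m e\<close> is the arc length along the edge up to an additive constant.\<close>

definition poly_on_edge :: "mesh \<Rightarrow> (real^3) set \<Rightarrow> nat \<Rightarrow> (real^3 \<Rightarrow> real) \<Rightarrow> bool" where
  "poly_on_edge m e d f \<longleftrightarrow> (\<exists>p. degree p \<le> d \<and> (\<forall>x\<in>e. f x = poly p (x \<bullet> tangent m e)))"

definition square_integrable :: "'a::euclidean_space set \<Rightarrow> ('a \<Rightarrow> real) \<Rightarrow> bool" where
  "square_integrable S f \<longleftrightarrow>
     f \<in> borel_measurable (lebesgue_on S) \<and> integrable (lebesgue_on S) (\<lambda>x. (f x)\<^sup>2)"

definition weak_partial :: "(real^2) set \<Rightarrow> 2 \<Rightarrow> (real^2 \<Rightarrow> real) \<Rightarrow> (real^2 \<Rightarrow> real) \<Rightarrow> bool" where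
  "weak_partial S i f w \<longleftrightarrow>
     (\<forall>\<psi>. smooth_on \<psi> UNIV \<and> (\<exists>C. compact C \<and> C \<subseteq> interior S \<and> (\<forall>x. x \<notin> C \<longrightarrow> \<psi> x = 0)) \<longrightarrow>
        (LINT x|lebesgue_on S. f x * partial i \<psi> x) = - (LINT x|lebesgue_on S. w x * \<psi> x))"

definition weak_gradient :: "(real^2) set \<Rightarrow> (real^2 \<Rightarrow> real) \<Rightarrow> (2 \<Rightarrow> real^2 \<Rightarrow> real) \<Rightarrow> bool" where
  "weak_gradient S f W \<longleftrightarrow> (\<forall>i. square_integrable S (W i) \<and> weak_partial S i f (W i))"

definition H1_on_tri :: "mesh \<Rightarrow> (real^3) set \<Rightarrow> (real^3 \<Rightarrow> real) \<Rightarrow> bool" where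
  "H1_on_tri m K u \<longleftrightarrow> square_integrable (tri_dom m K) (u \<circ> emb m K) \<and>
     (\<exists>W. weak_gradient (tri_dom m K) (u \<circ> emb m K) W)"

text \<open>\<open>w\<close> is the trace on the edge \<open>e\<close> of the \<open>H\<^sup>1\<close> function \<open>u\<close> on the triangle \<open>K\<close>: the \<open>L\<^sup>2\<close> limit of
  the restrictions to \<open>e\<close> of smooth functions that converge to \<open>u\<close> in \<open>H\<^sup>1\<close>.\<close>

definition has_trace ::
  "mesh \<Rightarrow> (real^3) set \<Rightarrow> (real^3) set \<Rightarrow> (real^3 \<Rightarrow> real) \<Rightarrow> (real^3 \<Rightarrow> real) \<Rightarrow> bool" where
  "has_trace m K e u w \<longleftrightarrow> H1_on_tri m K u \<and>
     square_integrable (edge_dom m e) (w \<circ> eemb m e) \<and>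
     (\<exists>W U. weak_gradient (tri_dom m K) (u \<circ> emb m K) W \<and>
        (\<forall>k::nat. smooth_on (U k) UNIV) \<and>
        (\<lambda>k. LINT \<xi>|lebesgue_on (tri_dom m K).
            (U k \<xi> - u (emb m K \<xi>))\<^sup>2 + (\<Sum>i\<in>UNIV. (partial i (U k) \<xi> - W i \<xi>)\<^sup>2)) \<longlonglongrightarrow> 0 \<and>
        (\<lambda>k. edge_integral m e (\<lambda>x. (U k (loc m K x) - w x)\<^sup>2)) \<longlonglongrightarrow> 0)"

definition edge_trace ::
  "mesh \<Rightarrow> (real^3) set \<Rightarrow> (real^3) set \<Rightarrow> (real^3 \<Rightarrow> real) \<Rightarrow> real^3 \<Rightarrow> real" where
  "edge_trace m K e u = (SOME w. has_trace m K e u w)"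

text \<open>The component \<open>\<sigma>(\<tau>, \<tau>)\<close> for the Euclidean unit tangent \<open>\<tau>\<close> of an edge \<open>e\<close> of \<open>K\<close>; it determines
  the pullback of \<open>\<sigma>\<close> to \<open>e\<close>.\<close>

definition tt_component ::
  "mesh \<Rightarrow> (real^3) set \<Rightarrow> (real^3) set \<Rightarrow> (real^3 \<Rightarrow> real^2^2) \<Rightarrow> real^3 \<Rightarrow> real" where
  "tt_component m K e \<sigma> x =
     (let \<tau> = (\<chi> i. tangent m e \<bullet> frame m K i) in \<tau> \<bullet> (\<sigma> x *v \<tau>))"

definition Sigma_space :: "mesh \<Rightarrow> mesh_tensor set" where
  "Sigma_space m = {\<sigma>.
     (\<forall>K\<in>triangles m. (\<forall>x\<in>K. transpose (\<sigma> K x) = \<sigma> K x) \<and>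
        (\<forall>i j. H1_on_tri m K (\<lambda>x. \<sigma> K x $ i $ j))) \<and>
     (\<forall>K\<in>triangles m. \<forall>K'\<in>triangles m. \<forall>e\<in>edges m. e \<subseteq> K \<inter> K' \<longrightarrow>
        (\<exists>w. has_trace m K e (tt_component m K e (\<sigma> K)) w \<and>
             has_trace m K' e (tt_component m K' e (\<sigma> K')) w))}"

definition Sigma_pos :: "mesh \<Rightarrow> mesh_tensor set" where
  "Sigma_pos m = {\<sigma> \<in> Sigma_space m.
     \<forall>K\<in>triangles m. \<forall>x\<in>K. \<forall>v. v \<noteq> 0 \<longrightarrow> v \<bullet> (\<sigma> K x *v v) > 0}"

definition Sigma_h :: "mesh \<Rightarrow> nat \<Rightarrow> mesh_tensor set" where
  "Sigma_h m r = {\<sigma> \<in> Sigma_space m. \<forall>K\<in>triangles m. poly_tensor_on_tri m K (int r) (\<sigma> K)}"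

definition V_h :: "mesh \<Rightarrow> nat \<Rightarrow> (real^3 \<Rightarrow> real) set" where
  "V_h m q = {v. continuous_on (carrier m) v \<and> (\<forall>K\<in>triangles m. poly_on_tri m K (int q) v)}"

section \<open>Metric-dependent forms\<close>

definition vol :: "mesh_tensor \<Rightarrow> (real^3) set \<Rightarrow> real^3 \<Rightarrow> real" where
  "vol g K x = sqrt (det (g K x))"

definition mesh_integral :: "mesh \<Rightarrow> mesh_tensor \<Rightarrow> (real^3 \<Rightarrow> real) \<Rightarrow> real" where
  "mesh_integral m g u = (\<Sum>K\<in>triangles m. tri_integral m K (\<lambda>x. u x * vol g K x))"

definition ip_fun :: "mesh \<Rightarrow> mesh_tensor \<Rightarrow> (real^3 \<Rightarrow> real) \<Rightarrow> (real^3 \<Rightarrow> real) \<Rightarrow> real" where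
  "ip_fun m g u v = mesh_integral m g (\<lambda>x. u x * v x)"

definition tri_gradient :: "mesh \<Rightarrow> (real^3) set \<Rightarrow> (real^3 \<Rightarrow> real) \<Rightarrow> real^3 \<Rightarrow> real^2" where
  "tri_gradient m K u x = (\<chi> i. frechet_derivative u (at x within K) (frame m K i))"

definition ip_grad :: "mesh \<Rightarrow> mesh_tensor \<Rightarrow> (real^3 \<Rightarrow> real) \<Rightarrow> (real^3 \<Rightarrow> real) \<Rightarrow> real" where
  "ip_grad m g u v = (\<Sum>K\<in>triangles m. tri_integral m K
     (\<lambda>x. ((matrix_inv (g K x) *v tri_gradient m K u x) \<bullet> tri_gradient m K v x) * vol g K x))"

definition ip_tensor_tri ::
  "mesh \<Rightarrow> mesh_tensor \<Rightarrow> (real^3) set \<Rightarrow> (real^3 \<Rightarrow> real^2^2) \<Rightarrow> (real^3 \<Rightarrow> real^2^2) \<Rightarrow> real" where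
  "ip_tensor_tri m g K \<sigma> \<rho> = tri_integral m K
     (\<lambda>x. trace (matrix_inv (g K x) ** \<sigma> x ** matrix_inv (g K x) ** \<rho> x) * vol g K x)"

definition ip_tensor :: "mesh \<Rightarrow> mesh_tensor \<Rightarrow> mesh_tensor \<Rightarrow> mesh_tensor \<Rightarrow> real" where
  "ip_tensor m g \<sigma> \<rho> = (\<Sum>K\<in>triangles m. ip_tensor_tri m g K (\<sigma> K) (\<rho> K))"

text \<open>\<open>\<langle>\<sigma>(\<tau>\<^sub>g, \<tau>\<^sub>g), v\<rangle>\<^bsub>g,e\<^esub>\<close>, evaluated from the side of the triangle \<open>K\<close>: here \<open>\<tau>\<^sub>g = \<tau> / sqrt (g(\<tau>, \<tau>))\<close>
  and \<open>ds\<^sub>g = sqrt (g(\<tau>, \<tau>)) ds\<close>.\<close>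

definition edge_moment ::
  "mesh \<Rightarrow> mesh_tensor \<Rightarrow> (real^3) set \<Rightarrow> (real^3) set \<Rightarrow> mesh_tensor \<Rightarrow> (real^3 \<Rightarrow> real) \<Rightarrow> real" where
  "edge_moment m g K e \<sigma> v =
     (let g\<tau> = edge_trace m K e (tt_component m K e (g K));
          \<sigma>\<tau> = edge_trace m K e (tt_component m K e (\<sigma> K))
      in edge_integral m e (\<lambda>x. \<sigma>\<tau> x / g\<tau> x * v x * sqrt (g\<tau> x)))"

section \<open>Projections\<close>

text \<open>Since fields are irrelevant off their triangle, the projections are stated as relations:
  \<open>P_proj m r g \<sigma> \<rho>\<close> means \<open>\<rho> = P\<^sub>g \<sigma>\<close>, and likewise below.\<close>

definition P_proj :: "mesh \<Rightarrow> nat \<Rightarrow> mesh_tensor \<Rightarrow> mesh_tensor \<Rightarrow> mesh_tensor \<Rightarrow> bool" where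
  "P_proj m r g \<sigma> \<rho> \<longleftrightarrow> g \<in> Sigma_pos m \<and> \<sigma> \<in> Sigma_space m \<and> \<rho> \<in> Sigma_h m r \<and>
     (\<forall>K\<in>triangles m. \<forall>e\<in>edges m. e \<subseteq> K \<longrightarrow>
        (\<forall>v. poly_on_edge m e r v \<longrightarrow> edge_moment m g K e \<rho> v = edge_moment m g K e \<sigma> v)) \<and>
     (\<forall>K\<in>triangles m. \<forall>\<eta>. poly_tensor_on_tri m K (int r - 1) \<eta> \<longrightarrow>
        ip_tensor_tri m g K (\<rho> K) \<eta> = ip_tensor_tri m g K (\<sigma> K) \<eta>)"

definition Pi_proj :: "mesh \<Rightarrow> nat \<Rightarrow> mesh_tensor \<Rightarrow> mesh_tensor \<Rightarrow> mesh_tensor \<Rightarrow> bool" where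
  "Pi_proj m r g \<sigma> \<rho> \<longleftrightarrow> g \<in> Sigma_pos m \<and> \<sigma> \<in> Sigma_space m \<and> \<rho> \<in> Sigma_h m r \<and>
     (\<forall>\<eta>\<in>Sigma_h m r. ip_tensor m g \<rho> \<eta> = ip_tensor m g \<sigma> \<eta>)"

definition flat_metric :: mesh_tensor where
  "flat_metric K x = mat 1"

definition P_h :: "mesh \<Rightarrow> nat \<Rightarrow> mesh_tensor \<Rightarrow> mesh_tensor \<Rightarrow> bool" where
  "P_h m r = P_proj m r flat_metric"

definition pullback :: "mesh \<Rightarrow> (real^3 \<Rightarrow> real^3) \<Rightarrow> surf_tensor \<Rightarrow> mesh_tensor" where
  "pullback m a \<sigma> K x = (\<chi> i j. \<sigma> (a x)
     (frechet_derivative a (at x within K) (frame m K i))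
     (frechet_derivative a (at x within K) (frame m K j)))"

definition lift :: "mesh \<Rightarrow> (real^3 \<Rightarrow> real^3) \<Rightarrow> (real^3 \<Rightarrow> real) \<Rightarrow> real^3 \<Rightarrow> real" where
  "lift m a f = f \<circ> inv_into (carrier m) a"

definition ritz_proj ::
  "mesh \<Rightarrow> nat \<Rightarrow> nat \<Rightarrow> (real^3) set \<Rightarrow> (real^3 \<Rightarrow> real^3) \<Rightarrow> surf_tensor \<Rightarrow>
   (real^3 \<Rightarrow> real) \<Rightarrow> (real^3 \<Rightarrow> real) \<Rightarrow> bool" where
  "ritz_proj m r q M a g u v \<longleftrightarrow> v \<in> V_h m q \<and>
     (\<exists>g_star. P_h m r (pullback m a g) g_star \<and>
        (\<forall>\<phi>\<in>V_h m q. ip_grad m g_star v \<phi> =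
           surf_integral M g (\<lambda>x. g x (surf_gradient M g u x) (surf_gradient M g (lift m a \<phi>) x)))) \<and>
     surf_integral M euclidean_metric (lift m a v) = surf_integral M euclidean_metric u"

section \<open>The schemes\<close>

text \<open>The argument \<open>Q\<close> stands for the projection: \<open>Q g \<sigma> \<rho>\<close> means that \<open>\<rho>\<close> is the projection of \<open>\<sigma>\<close>
  with respect to the metric \<open>g\<close>.\<close>

definition scheme ::
  "(mesh_tensor \<Rightarrow> mesh_tensor \<Rightarrow> mesh_tensor \<Rightarrow> bool) \<Rightarrow>
   mesh \<Rightarrow> nat \<Rightarrow> nat \<Rightarrow> (real^3) set \<Rightarrow> (real^3 \<Rightarrow> real^3) \<Rightarrow> real \<Rightarrow>
   (real \<Rightarrow> surf_tensor) \<Rightarrow> (real \<Rightarrow> real^3 \<Rightarrow> real) \<Rightarrow>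
   (real \<Rightarrow> mesh_tensor) \<Rightarrow> (real \<Rightarrow> real^3 \<Rightarrow> real) \<Rightarrow> bool" where
  "scheme Q m r q M a T g \<kappa> gh \<kappa>h \<longleftrightarrow>
     P_h m r (pullback m a (g 0)) (gh 0) \<and> ritz_proj m r q M a (g 0) (\<kappa> 0) (\<kappa>h 0) \<and>
     (let \<kappa>bar = mesh_integral m (gh 0) (\<kappa>h 0) / mesh_integral m (gh 0) (\<lambda>_. 1) in
      \<forall>t\<in>{0..T}. gh t \<in> Sigma_h m r \<and> gh t \<in> Sigma_pos m \<and> \<kappa>h t \<in> V_h m q \<and>
        (\<exists>\<rho>. Q (gh t) (\<lambda>K x. (\<kappa>h t x - \<kappa>bar) *\<^sub>R gh t K x) \<rho> \<and>
           (\<forall>K\<in>triangles m. \<forall>x\<in>K.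
              ((\<lambda>s. gh s K x) has_vector_derivative - 2 *\<^sub>R \<rho> K x) (at t within {0..T}))) \<and>
        (\<forall>\<phi>\<in>V_h m q. ((\<lambda>s. ip_fun m (gh s) (\<kappa>h s) \<phi>) has_real_derivative
            - ip_grad m (gh t) (\<kappa>h t) \<phi>) (at t within {0..T})))"

definition scheme_P where
  "scheme_P m r q M a T g \<kappa> gh \<kappa>h \<longleftrightarrow> scheme (P_proj m r) m r q M a T g \<kappa> gh \<kappa>h"

definition scheme_Pi where
  "scheme_Pi m r q M a T g \<kappa> gh \<kappa>h \<longleftrightarrow> scheme (Pi_proj m r) m r q M a T g \<kappa> gh \<kappa>h"

end

theory Submission
  imports Defs
begin

text \<open>Testing the curvature equation with the constant function 1 gives the discrete Gauss--Bonnet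
  identity. For the area \<open>A\<close>, Jacobi's formula gives \<open>A' = -(\<rho>, g\<^sub>h)\<close>, where \<open>\<rho>\<close> is the projection of
  \<open>(\<kappa>\<^sub>h - k) g\<^sub>h\<close> and \<open>k\<close> is the average curvature at time 0. In Scheme \<open>\<Pi>\<close> the metric \<open>g\<^sub>h\<close> is itself
  an admissible test tensor, so \<open>A' = -2 (\<integral>\<kappa>\<^sub>h - k A) = 2 k (A - A(0))\<close> by Gauss--Bonnet, and
  \<open>A - A(0)\<close> vanishes as the solution of a linear equation with zero initial value.\<close>

section \<open>Differentiation of the area integral\<close>

text \<open>Interpolation that tolerates linearly dependent \<open>b i\<close>: only reproduction of
  the span is asked for, not that each \<open>L k\<close> vanishes at the other nodes. The
  \<open>L k\<close> are independent of \<open>c\<close>, so a time-dependent element of the span is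
  governed by finitely many scalars, its values at the nodes. Nodes are added one at a time, as in
  Newton interpolation.\<close>

lemma interpolation_finite_span:
  fixes b :: "'i \<Rightarrow> 'a::topological_space \<Rightarrow> real"
  assumes "finite I" and "X \<noteq> {}" and "\<And>i. i \<in> I \<Longrightarrow> continuous_on X (b i)"
  shows "\<exists>p L. (\<forall>k\<in>I. p k \<in> X \<and> continuous_on X (L k)) \<and>
    (\<forall>c. \<forall>x\<in>X. (\<Sum>i\<in>I. c i * b i x) = (\<Sum>k\<in>I. (\<Sum>i\<in>I. c i * b i (p k)) * L k x))"
  using assms(1,3)
proof (induction I rule: finite_induct)
  case empty
  show ?case by simp
next
  case (insert j I)
  have "\<exists>p L. (\<forall>k\<in>I. p k \<in> X \<and> continuous_on X (L k)) \<and>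
      (\<forall>c. \<forall>x\<in>X. (\<Sum>i\<in>I. c i * b i x) = (\<Sum>k\<in>I. (\<Sum>i\<in>I. c i * b i (p k)) * L k x))"
    by (rule insert.IH) (simp add: insert.prems)
  then obtain p L where pL: "(\<forall>k\<in>I. p k \<in> X \<and> continuous_on X (L k)) \<and>
      (\<forall>c. \<forall>x\<in>X. (\<Sum>i\<in>I. c i * b i x) = (\<Sum>k\<in>I. (\<Sum>i\<in>I. c i * b i (p k)) * L k x))"
    by (elim exE)
  have p: "p k \<in> X" and L: "continuous_on X (L k)" if "k \<in> I" for k
    using pL that by blast+
  have rep: "(\<Sum>i\<in>I. c i * b i x) = (\<Sum>k\<in>I. (\<Sum>i\<in>I. c i * b i (p k)) * L k x)"
    if "x \<in> X" for c x
    using pL that by blast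
  have bj: "continuous_on X (b j)" using insert.prems by simp
  \<comment> \<open>The part of \<open>b j\<close> that interpolation at the old nodes
    misses.\<close>
  define \<delta> where "\<delta> x = b j x - (\<Sum>k\<in>I. b j (p k) * L k x)" for x
  have \<delta>: "continuous_on X \<delta>"
    unfolding \<delta>_def by (intro continuous_intros bj L)
  \<comment> \<open>The new node is a point where the residual is nonzero if there is one, and an
    arbitrary point of \<open>X\<close> otherwise.\<close>
  obtain x0 where x0: "x0 \<in> X" "\<delta> x0 = 0 \<Longrightarrow> (\<forall>x\<in>X. \<delta> x = 0)"
    using \<open>X \<noteq> {}\<close> by blast
  \<comment> \<open>If \<open>\<delta>\<close> vanishes on \<open>X\<close>, division by zero makes \<open>N\<close> zero and the new node is redundant.\<close>
  define N where "N x = \<delta> x / \<delta> x0" for x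
  \<comment> \<open>If \<open>\<delta> x0\<close> is nonzero, then \<open>N\<close> equals 1 at
    \<open>x0\<close>, and the correction makes the old \<open>L k\<close> vanish there.\<close>
  define L' where "L' k x = (if k = j then N x else L k x - L k x0 * N x)" for k x
  have N: "continuous_on X N"
    unfolding N_def divide_inverse by (intro continuous_intros \<delta>)
  have \<delta>N: "\<delta> x = \<delta> x0 * N x" if "x \<in> X" for x
    using x0 that by (auto simp: N_def)
  have *: "(\<Sum>i\<in>insert j I. c i * b i x) =
      (\<Sum>k\<in>insert j I. (\<Sum>i\<in>insert j I. c i * b i ((p(j := x0)) k)) * L' k x)"
    if x: "x \<in> X" for c x
  proof -
    define f where "f y = (\<Sum>i\<in>insert j I. c i * b i y)" for y
    \<comment> \<open>The old nodes reproduce the terms over \<open>I\<close> exactly, so the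
      interpolation error is \<open>c j\<close> times the residual.\<close>
    have f: "f y = (\<Sum>k\<in>I. f (p k) * L k y) + c j * \<delta> y" if "y \<in> X" for y
    proof -
      have "(\<Sum>k\<in>I. f (p k) * L k y) =
          c j * (\<Sum>k\<in>I. b j (p k) * L k y) + (\<Sum>k\<in>I. (\<Sum>i\<in>I. c i * b i (p k)) * L k y)"
        using insert.hyps
        by (simp add: f_def algebra_simps sum.distrib sum_distrib_left sum_distrib_right)
      then show ?thesis
        using insert.hyps rep[OF that, of c] by (simp add: f_def \<delta>_def algebra_simps)
    qed
    have "(\<Sum>k\<in>insert j I. f ((p(j := x0)) k) * L' k x) =
        f x0 * N x + (\<Sum>k\<in>I. f (p k) * (L k x - L k x0 * N x))"
    proof -
      have "(\<Sum>k\<in>I. f ((p(j := x0)) k) * L' k x) = (\<Sum>k\<in>I. f (p k) * (L k x - L k x0 * N x))"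
        using insert.hyps by (intro sum.cong) (auto simp: L'_def)
      then show ?thesis using insert.hyps by (simp add: L'_def)
    qed
    also have "\<dots> = (f x0 - (\<Sum>k\<in>I. f (p k) * L k x0)) * N x + (\<Sum>k\<in>I. f (p k) * L k x)"
      by (simp add: algebra_simps sum_subtractf sum_distrib_left sum_distrib_right)
    \<comment> \<open>The error formula at \<open>x0\<close> identifies the bracket as
      \<open>c j * \<delta> x0\<close>; multiplied by \<open>N x\<close> it is the error at
      \<open>x\<close>.\<close>
    also have "\<dots> = f x"
      using f[OF x0(1)] f[OF x] \<delta>N[OF x] by simp
    finally show ?thesis by (simp add: f_def)
  qed
  have "\<forall>k\<in>insert j I. (p(j := x0)) k \<in> X \<and> continuous_on X (L' k)"
  proof
    fix k assume "k \<in> insert j I"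
    then show "(p(j := x0)) k \<in> X \<and> continuous_on X (L' k)"
      using p x0(1) N L by (cases "k = j") (auto simp: L'_def[abs_def] intro!: continuous_intros)
  qed
  with * show ?case by blast
qed

lemma integrable_continuous_compact:
  fixes f :: "'a::euclidean_space \<Rightarrow> real"
  assumes "compact X" and "continuous_on X f"
  shows "integrable (lebesgue_on X) f"
proof -
  have X: "X \<in> lmeasurable" using assms(1) by (rule lmeasurable_compact)
  interpret finite_measure "lebesgue_on X" using X by (rule finite_measure_lebesgue_on)
  obtain B where "\<And>x. x \<in> X \<Longrightarrow> norm (f x) \<le> B"
    using compact_imp_bounded[OF compact_continuous_image[OF assms(2,1)]]
    by (auto simp: bounded_iff)
  then show ?thesis
    using X assms(2)
    by (intro integrable_const_bound[where B = B] AE_I2 continuous_imp_measurable_on_sets_lebesgue)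
      auto
qed

text \<open>In a finite-dimensional space of functions, interpolation turns pointwise differentiability in
  time into difference quotients that are bounded uniformly in space, so that no regularity of the
  time derivative is needed.\<close>

lemma has_derivative_integral_sqrt:
  fixes D :: "real \<Rightarrow> 'a::euclidean_space \<Rightarrow> real" and b :: "'i \<Rightarrow> 'a \<Rightarrow> real"
  assumes X: "compact X" and I: "finite I" and b: "\<And>i. i \<in> I \<Longrightarrow> continuous_on X (b i)"
    and span: "\<And>s. s \<in> S \<Longrightarrow> \<exists>c. \<forall>x\<in>X. D s x = (\<Sum>i\<in>I. c i * b i x)"
    and pos: "\<And>s x. s \<in> S \<Longrightarrow> x \<in> X \<Longrightarrow> 0 < D s x"
    and der: "\<And>x. x \<in> X \<Longrightarrow> ((\<lambda>s. D s x) has_real_derivative D' x) (at t within S)"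
    and t: "t \<in> S"
  shows "((\<lambda>s. LINT x|lebesgue_on X. sqrt (D s x)) has_real_derivative
    (LINT x|lebesgue_on X. D' x / (2 * sqrt (D t x)))) (at t within S)"
proof (cases "X = {}")
  case True
  then have "(LINT x|lebesgue_on X. f x) = 0" for f :: "'a \<Rightarrow> real"
    by (intro integral_eq_zero_AE AE_I2) simp
  then show ?thesis by simp
next
  case False
  have "\<exists>p L. (\<forall>k\<in>I. p k \<in> X \<and> continuous_on X (L k)) \<and>
      (\<forall>c. \<forall>x\<in>X. (\<Sum>i\<in>I. c i * b i x) = (\<Sum>k\<in>I. (\<Sum>i\<in>I. c i * b i (p k)) * L k x))"
    by (rule interpolation_finite_span[OF I False b])
  then obtain p L where pL: "(\<forall>k\<in>I. p k \<in> X \<and> continuous_on X (L k)) \<and>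
      (\<forall>c. \<forall>x\<in>X. (\<Sum>i\<in>I. c i * b i x) = (\<Sum>k\<in>I. (\<Sum>i\<in>I. c i * b i (p k)) * L k x))"
    by (elim exE)
  have p: "p k \<in> X" and L: "continuous_on X (L k)" if "k \<in> I" for k
    using pL that by blast+
  have rep: "(\<Sum>i\<in>I. c i * b i x) = (\<Sum>k\<in>I. (\<Sum>i\<in>I. c i * b i (p k)) * L k x)"
    if "x \<in> X" for c x
    using pL that by blast
  \<comment> \<open>The unknown span coefficients of \<open>D s\<close> are traded for its nodal
    values, whose differentiability at \<open>t\<close> is given by \<open>der\<close>.\<close>
  have D: "D s x = (\<Sum>k\<in>I. D s (p k) * L k x)" if "s \<in> S" "x \<in> X" for s x
  proof -
    obtain c where c: "\<And>x. x \<in> X \<Longrightarrow> D s x = (\<Sum>i\<in>I. c i * b i x)"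
      using span[OF \<open>s \<in> S\<close>] by blast
    have "(\<Sum>k\<in>I. D s (p k) * L k x) = (\<Sum>k\<in>I. (\<Sum>i\<in>I. c i * b i (p k)) * L k x)"
      by (intro sum.cong refl) (simp add: c p)
    then show ?thesis using rep[OF \<open>x \<in> X\<close>, of c] c[OF \<open>x \<in> X\<close>] by simp
  qed
  have Dcont: "continuous_on X (D s)" if "s \<in> S" for s
  proof -
    have "continuous_on X (\<lambda>x. \<Sum>k\<in>I. D s (p k) * L k x)"
      by (intro continuous_intros L)
    then show ?thesis using D[OF that] by (simp cong: continuous_on_cong)
  qed
  have sqrt_cont: "continuous_on X (\<lambda>x. sqrt (D s x))" if "s \<in> S" for s
    by (intro continuous_intros Dcont that)
  have int: "integrable (lebesgue_on X) (\<lambda>x. sqrt (D s x))" if "s \<in> S" for s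
    by (rule integrable_continuous_compact[OF X sqrt_cont[OF that]])
  define Q where "Q s x = (sqrt (D s x) - sqrt (D t x)) / (s - t)" for s x
  have sqrt_der: "((\<lambda>s. sqrt (D s x)) has_real_derivative D' x / (2 * sqrt (D t x))) (at t within S)"
    if "x \<in> X" for x
    using DERIV_chain2[OF DERIV_real_sqrt[OF pos[OF t that]] der[OF that]]
    by (simp add: field_simps)
  have "((\<lambda>s. LINT x|lebesgue_on X. Q s x) \<longlongrightarrow>
      (LINT x|lebesgue_on X. D' x / (2 * sqrt (D t x)))) (at t within S)"
    \<comment> \<open>Dominated convergence concerns sequences, so the limit is taken along an
      arbitrary sequence in \<open>S - {t}\<close> that tends to \<open>t\<close>.\<close>
    unfolding tendsto_at_iff_sequentially comp_def
  proof (intro allI impI)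
    fix \<sigma> :: "nat \<Rightarrow> real"
    assume \<sigma>S: "\<forall>i. \<sigma> i \<in> S - {t}" and \<sigma>: "\<sigma> \<longlonglongrightarrow> t"
    have seq: "(\<lambda>i. (f (\<sigma> i) - f t) / (\<sigma> i - t)) \<longlonglongrightarrow> f'"
      if "(f has_real_derivative f') (at t within S)" for f f'
      using that \<sigma>S \<sigma> unfolding has_field_derivative_iff tendsto_at_iff_sequentially comp_def
      by blast
    \<comment> \<open>Difference quotients at a node converge, hence are bounded along the sequence;
      finitely many such bounds control all of \<open>X\<close>.\<close>
    have "\<exists>B. \<forall>i. \<bar>(D (\<sigma> i) (p k) - D t (p k)) / (\<sigma> i - t)\<bar> \<le> B" if "k \<in> I" for k
      using convergent_imp_Bseq[OF convergentI[OF seq[OF der[OF p[OF that]]]]]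
      by (auto simp: Bseq_def)
    then obtain B where B: "\<And>k i. k \<in> I \<Longrightarrow> \<bar>(D (\<sigma> i) (p k) - D t (p k)) / (\<sigma> i - t)\<bar> \<le> B k"
      by metis
    have Qcont: "continuous_on X (Q s)" if "s \<in> S" for s
      unfolding Q_def divide_inverse by (intro continuous_intros sqrt_cont that t)
    have lim: "(\<lambda>i. Q (\<sigma> i) x) \<longlonglongrightarrow> D' x / (2 * sqrt (D t x))" if "x \<in> X" for x
      unfolding Q_def by (rule seq[OF sqrt_der[OF that]])
    have Qmeas: "Q (\<sigma> i) \<in> borel_measurable (lebesgue_on X)" for i
      using \<sigma>S X by (intro continuous_imp_measurable_on_sets_lebesgue Qcont)
        (auto simp: fmeasurableD lmeasurable_compact)
    \<comment> \<open>A difference of square roots is the difference of the radicands over the sum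
      of the roots. Keeping only the root at time \<open>t\<close> in that sum gives a majorant free
      of \<open>i\<close>.\<close>
    have bound: "\<bar>Q (\<sigma> i) x\<bar> \<le> (\<Sum>k\<in>I. B k * \<bar>L k x\<bar>) / sqrt (D t x)" if x: "x \<in> X" for i x
    proof -
      have s: "\<sigma> i \<in> S" "\<sigma> i \<noteq> t" using \<sigma>S by auto
      have pt: "0 < D t x" and ps: "0 < D (\<sigma> i) x" using pos t s x by auto
      have "(D (\<sigma> i) x - D t x) / (\<sigma> i - t) =
          (\<Sum>k\<in>I. (D (\<sigma> i) (p k) - D t (p k)) / (\<sigma> i - t) * L k x)"
        using D[OF s(1) x] D[OF t x]
        by (simp add: sum_divide_distrib diff_divide_distrib sum_subtractf algebra_simps)
      also have "\<bar>\<dots>\<bar> \<le> (\<Sum>k\<in>I. B k * \<bar>L k x\<bar>)"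
        by (intro order_trans[OF sum_abs] sum_mono)
          (simp only: abs_mult, intro mult_right_mono B abs_ge_zero)
      finally have 1: "\<bar>(D (\<sigma> i) x - D t x) / (\<sigma> i - t)\<bar> \<le> (\<Sum>k\<in>I. B k * \<bar>L k x\<bar>)" .
      have "D (\<sigma> i) x - D t x = (sqrt (D (\<sigma> i) x) - sqrt (D t x)) * (sqrt (D (\<sigma> i) x) + sqrt (D t x))"
        using pt ps by (simp add: algebra_simps)
      then have 2: "Q (\<sigma> i) x * (sqrt (D (\<sigma> i) x) + sqrt (D t x)) = (D (\<sigma> i) x - D t x) / (\<sigma> i - t)"
        by (simp add: Q_def)
      have "\<bar>Q (\<sigma> i) x\<bar> * sqrt (D t x) \<le> \<bar>Q (\<sigma> i) x\<bar> * (sqrt (D (\<sigma> i) x) + sqrt (D t x))"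
        using ps by (intro mult_left_mono) auto
      also have "\<dots> = \<bar>Q (\<sigma> i) x * (sqrt (D (\<sigma> i) x) + sqrt (D t x))\<bar>"
        using ps pt by (simp add: abs_mult)
      also have "\<dots> \<le> (\<Sum>k\<in>I. B k * \<bar>L k x\<bar>)" using 1 2 by simp
      finally show ?thesis using pt by (simp add: field_simps)
    qed
    show "(\<lambda>i. LINT x|lebesgue_on X. Q (\<sigma> i) x) \<longlonglongrightarrow>
        (LINT x|lebesgue_on X. D' x / (2 * sqrt (D t x)))"
    proof (rule integral_dominated_convergence)
      show "Q (\<sigma> i) \<in> borel_measurable (lebesgue_on X)" for i
        by (rule Qmeas)
      \<comment> \<open>Nothing is assumed about \<open>D'\<close> as a function of
        \<open>x\<close>; measurability is inherited from the quotients as their pointwise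
        limit.\<close>
      show "(\<lambda>x. D' x / (2 * sqrt (D t x))) \<in> borel_measurable (lebesgue_on X)"
        by (rule borel_measurable_LIMSEQ_metric[OF Qmeas lim]) simp
      show "integrable (lebesgue_on X) (\<lambda>x. (\<Sum>k\<in>I. B k * \<bar>L k x\<bar>) / sqrt (D t x))"
        using pos[OF t]
        by (intro integrable_continuous_compact X continuous_intros L sqrt_cont t) force+
      show "AE x in lebesgue_on X. (\<lambda>i. Q (\<sigma> i) x) \<longlonglongrightarrow> D' x / (2 * sqrt (D t x))"
        by (rule AE_I2) (simp add: lim)
      show "AE x in lebesgue_on X. norm (Q (\<sigma> i) x) \<le> (\<Sum>k\<in>I. B k * \<bar>L k x\<bar>) / sqrt (D t x)" for i
        by (rule AE_I2) (simp add: bound)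
    qed
  qed
  moreover have "(LINT x|lebesgue_on X. Q s x) =
      ((LINT x|lebesgue_on X. sqrt (D s x)) - (LINT x|lebesgue_on X. sqrt (D t x))) / (s - t)"
    if "s \<in> S" for s
    using int[OF that] int[OF t] by (simp add: Q_def)
  ultimately show ?thesis
    unfolding has_field_derivative_iff
    by (rule Lim_transform_within[OF _ zero_less_one]) simp
qed

section \<open>Metrics in two dimensions\<close>

lemma matrix_inv_left_right:
  fixes A :: "real^'n^'n"
  assumes "det A \<noteq> 0"
  shows "matrix_inv A ** A = mat 1" and "A ** matrix_inv A = mat 1"
proof -
  obtain B where "A ** B = mat 1 \<and> B ** A = mat 1"
    using assms invertible_det_nz[of A] unfolding invertible_def by blast
  then have "A ** matrix_inv A = mat 1 \<and> matrix_inv A ** A = mat 1"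
    unfolding matrix_inv_def by (rule someI)
  then show "matrix_inv A ** A = mat 1" and "A ** matrix_inv A = mat 1" by auto
qed

lemma det_pos_2:
  fixes A :: "real^2^2"
  assumes sym: "transpose A = A" and pos: "\<And>v. v \<noteq> 0 \<Longrightarrow> v \<bullet> (A *v v) > 0"
  shows "0 < det A"
proof -
  have s: "A $ 2 $ 1 = A $ 1 $ 2"
    using arg_cong[OF sym, of "\<lambda>B. B $ 1 $ 2"] by (simp add: transpose_def)
  have a: "0 < A $ 1 $ 1"
    using pos[of "vector [1, 0]"]
    by (simp add: vec_eq_iff forall_2 inner_vec_def sum_2 matrix_vector_mult_def)
  \<comment> \<open>Chosen so that \<open>A *v v\<close> has first component 0 and second component
    \<open>det A\<close>.\<close>
  define v :: "real^2" where "v = vector [- A $ 1 $ 2, A $ 1 $ 1]"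
  have "v \<noteq> 0" using a by (auto simp: v_def vec_eq_iff forall_2)
  then have "0 < v \<bullet> (A *v v)" by (rule pos)
  also have "v \<bullet> (A *v v) = A $ 1 $ 1 * det A"
    by (simp add: v_def inner_vec_def sum_2 matrix_vector_mult_def det_2 s algebra_simps)
  finally show ?thesis using a by (simp add: zero_less_mult_iff)
qed

text \<open>Jacobi's formula: \<open>det A\<close> times the inverse is the adjugate, and the
  right-hand side is the derivative of the determinant at \<open>A\<close> in the direction
  \<open>B\<close>.\<close>

lemma det_mult_trace_inv_2:
  fixes A B :: "real^2^2"
  assumes "det A \<noteq> 0"
  shows "det A * trace (matrix_inv A ** B) =
    B $ 1 $ 1 * A $ 2 $ 2 + A $ 1 $ 1 * B $ 2 $ 2 - B $ 1 $ 2 * A $ 2 $ 1 - A $ 1 $ 2 * B $ 2 $ 1"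
proof -
  define H where "H = matrix_inv A"
  have "H ** A = mat 1" using matrix_inv_left_right(1)[OF assms] by (simp add: H_def)
  then have "(H ** A) $ i $ j = (mat 1 :: real^2^2) $ i $ j" for i j by simp
  from this[of 1 1] this[of 1 2] this[of 2 1] this[of 2 2]
  have e: "H $ 1 $ 1 * A $ 1 $ 1 + H $ 1 $ 2 * A $ 2 $ 1 = 1"
    "H $ 1 $ 1 * A $ 1 $ 2 + H $ 1 $ 2 * A $ 2 $ 2 = 0"
    "H $ 2 $ 1 * A $ 1 $ 1 + H $ 2 $ 2 * A $ 2 $ 1 = 0"
    "H $ 2 $ 1 * A $ 1 $ 2 + H $ 2 $ 2 * A $ 2 $ 2 = 1"
    by (simp_all add: matrix_matrix_mult_def sum_2 mat_def)
  have "det A * H $ 1 $ 1 = A $ 2 $ 2" "det A * H $ 1 $ 2 = - A $ 1 $ 2"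
    "det A * H $ 2 $ 1 = - A $ 2 $ 1" "det A * H $ 2 $ 2 = A $ 1 $ 1"
    using e unfolding det_2 by algebra+
  moreover have "det A * trace (H ** B) = (det A * H $ 1 $ 1) * B $ 1 $ 1 +
      (det A * H $ 1 $ 2) * B $ 2 $ 1 + (det A * H $ 2 $ 1) * B $ 1 $ 2 + (det A * H $ 2 $ 2) * B $ 2 $ 2"
    by (simp add: trace_def matrix_matrix_mult_def sum_2 algebra_simps)
  ultimately show ?thesis
    unfolding H_def[symmetric] by simp
qed

section \<open>Triangles and piecewise polynomials\<close>

lemma loc_emb:
  assumes "triangular_mesh m" and "K \<in> triangles m"
  shows "loc m K (emb m K \<xi>) = \<xi>"
proof -
  have fr: "frame m K i \<bullet> frame m K j = (if i = j then 1 else 0)" for i j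
    using assms unfolding triangular_mesh_def by blast
  show ?thesis
    unfolding vec_eq_iff forall_2 by (simp add: loc_def emb_def inner_add_left sum_2 fr)
qed

lemma continuous_emb: "continuous_on X (emb m K)"
  unfolding emb_def by (intro continuous_intros)

text \<open>The domain is closed as a preimage of \<open>K\<close>, and bounded because
  \<open>loc\<close> recovers the coordinates and so places it inside the compact image of
  \<open>K\<close>.\<close>

lemma compact_tri_dom:
  assumes "triangular_mesh m" and "K \<in> triangles m"
  shows "compact (tri_dom m K)"
proof -
  have K: "compact K"
    using assms unfolding triangular_mesh_def by (blast intro: compact_simplex)
  have "continuous_on K (loc m K)"
    unfolding loc_def by (intro continuous_intros continuous_on_vec_lambda)
  then have "compact (loc m K ` K)" using K by (rule compact_continuous_image)
  moreover have "tri_dom m K \<subseteq> loc m K ` K"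
    using loc_emb[OF assms] by (auto simp: tri_dom_def image_iff) metis
  moreover have "closed (tri_dom m K)"
    using closed_vimage[OF compact_imp_closed[OF K] continuous_emb[of UNIV m K]]
    by (simp add: tri_dom_def vimage_def)
  ultimately show ?thesis by (metis closed_Int_compact inf.absorb_iff1)
qed

text \<open>Exponent pairs serve as a single index, so that products of two polynomials are indexed
  by a product set. The set is empty for negative \<open>d\<close>.\<close>

definition mono_ix :: "int \<Rightarrow> (nat \<times> nat) set" where
  "mono_ix d = {(i, j). int (i + j) \<le> d}"

definition mono2 :: "nat \<times> nat \<Rightarrow> real^2 \<Rightarrow> real" where
  "mono2 \<alpha> \<xi> = \<xi> $ 1 ^ fst \<alpha> * \<xi> $ 2 ^ snd \<alpha>"

lemma finite_mono_ix: "finite (mono_ix d)"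
  by (rule finite_subset[of _ "{..nat d} \<times> {..nat d}"]) (auto simp: mono_ix_def)

lemma continuous_mono2: "continuous_on X (mono2 \<alpha>)"
  unfolding mono2_def by (intro continuous_intros)

lemma poly_on_tri_emb:
  assumes "triangular_mesh m" and "K \<in> triangles m" and "poly_on_tri m K d f"
  obtains c where "\<And>\<xi>. \<xi> \<in> tri_dom m K \<Longrightarrow> f (emb m K \<xi>) = (\<Sum>\<alpha>\<in>mono_ix d. c \<alpha> * mono2 \<alpha> \<xi>)"
proof -
  obtain c where c: "\<forall>x\<in>K. f x =
      (\<Sum>(i, j)\<in>{(i, j). int (i + j) \<le> d}. c i j * (loc m K x $ 1) ^ i * (loc m K x $ 2) ^ j)"
    using assms(3) unfolding poly_on_tri_def by blast
  show thesis
    by (rule that[of "\<lambda>\<alpha>. c (fst \<alpha>) (snd \<alpha>)"])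
      (simp add: tri_dom_def c loc_emb[OF assms(1,2)] mono_ix_def mono2_def case_prod_beta mult.assoc)
qed

text \<open>Makes constants admissible test functions in the curvature equation; the index
  \<open>(0, 0)\<close> is available for every degree \<open>q\<close>.\<close>

lemma const_in_V_h: "(\<lambda>_. k) \<in> V_h m q"
proof -
  have "poly_on_tri m K (int q) (\<lambda>_. k)" for K
    unfolding poly_on_tri_def
  proof (intro exI ballI)
    fix x
    have "(\<Sum>\<alpha>\<in>mono_ix (int q). (if \<alpha> = (0, 0) then k else 0)) = k"
      using finite_mono_ix by (simp add: sum.delta mono_ix_def)
    also have "(\<Sum>\<alpha>\<in>mono_ix (int q). (if \<alpha> = (0, 0) then k else 0)) =
        (\<Sum>(i, j)\<in>mono_ix (int q). (if i = 0 \<and> j = 0 then k else 0) *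
          (loc m K x $ 1) ^ i * (loc m K x $ 2) ^ j)"
      by (intro sum.cong) (auto split: prod.splits)
    finally show "k = (\<Sum>(i, j)\<in>{(i, j). int (i + j) \<le> int q}. (if i = 0 \<and> j = 0 then k else 0) *
          (loc m K x $ 1) ^ i * (loc m K x $ 2) ^ j)"
      by (simp add: mono_ix_def)
  qed
  then show ?thesis by (simp add: V_h_def)
qed

text \<open>The derivative within a triangle is an arbitrary choice off the tangent plane, but convexity
  determines it on the differences of points of the triangle, which span that plane.\<close>

lemma tri_gradient_const:
  assumes m: "triangular_mesh m" and K: "K \<in> triangles m" and x: "x \<in> K"
  shows "tri_gradient m K (\<lambda>_. k) x = 0"
proof -
  define F where "F = frechet_derivative (\<lambda>_::real^3. k) (at x within K)"
  have F: "((\<lambda>_. k) has_derivative F) (at x within K)"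
    unfolding F_def frechet_derivative_works[symmetric] by simp
  then have lin: "linear F" by (rule has_derivative_linear)
  have "convex K"
    using m K unfolding triangular_mesh_def by (blast intro: convex_simplex)
  have z: "F (y - x) = 0" if y: "y \<in> K" for y
  proof -
    \<comment> \<open>Along the segment from \<open>x\<close> to \<open>y\<close> the constant has
      both \<open>F (y - x)\<close> and 0 as derivative, and a one-sided derivative is
      unique.\<close>
    define \<gamma> where "\<gamma> h = x + h *\<^sub>R (y - x)" for h :: real
    have im: "\<gamma> ` {0..1} \<subseteq> K"
      using convexD_alt[OF \<open>convex K\<close> x y] by (auto simp: \<gamma>_def algebra_simps)
    have "(\<gamma> has_derivative (\<lambda>h. h *\<^sub>R (y - x))) (at 0 within {0..1})"
      unfolding \<gamma>_def by (auto intro!: derivative_eq_intros)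
    moreover have "((\<lambda>_. k) has_derivative F) (at (\<gamma> 0) within \<gamma> ` {0..1})"
      using has_derivative_subset[OF F im] by (simp add: \<gamma>_def)
    ultimately have "((\<lambda>_. k) has_derivative (\<lambda>h. F (h *\<^sub>R (y - x)))) (at 0 within {0..1::real})"
      by (rule has_derivative_in_compose)
    then have "((\<lambda>_. k) has_field_derivative F (y - x)) (at 0 within {0..1})"
      by (simp add: has_field_derivative_def linear_scale[OF lin] mult_commute_abs)
    moreover have "((\<lambda>_. k) has_field_derivative 0) (at 0 within {0..1})" by simp
    moreover have "at 0 within {0..1::real} \<noteq> bot" by (simp add: trivial_limit_within islimpt_Icc)
    ultimately have "F (y - x) = 0" by (rule has_field_derivative_unique)
    then show ?thesis by simp
  qed
  have "F w = 0" if "w \<in> span {y - x | x y. x \<in> K \<and> y \<in> K}" for w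
  proof (rule linear_eq_0_on_span[OF lin _ that])
    fix w assume "w \<in> {y - x | x y. x \<in> K \<and> y \<in> K}"
    then obtain u v where w: "w = v - u" "u \<in> K" "v \<in> K" by blast
    \<comment> \<open>A difference of two arbitrary points is reduced to differences based at
      \<open>x\<close>, where \<open>z\<close> applies.\<close>
    have "F w = F (v - x) - F (u - x)"
      unfolding w(1) by (simp flip: linear_diff[OF lin])
    then show "F w = 0" using z w by simp
  qed
  moreover have "frame m K i \<in> span {y - x | x y. x \<in> K \<and> y \<in> K}" for i
    using m K unfolding triangular_mesh_def by blast
  ultimately show ?thesis
    by (simp add: tri_gradient_def vec_eq_iff flip: F_def)
qed

lemma tri_integral_cong:
  assumes "\<And>x. x \<in> K \<Longrightarrow> f x = h x"
  shows "tri_integral m K f = tri_integral m K h"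
  unfolding tri_integral_def
  by (intro Bochner_Integration.integral_cong) (auto simp: tri_dom_def assms)

lemma ip_grad_const_right:
  assumes "triangular_mesh m"
  shows "ip_grad m g u (\<lambda>_. k) = 0"
proof -
  have "tri_integral m K (\<lambda>x. ((matrix_inv (g K x) *v tri_gradient m K u x) \<bullet>
      tri_gradient m K (\<lambda>_. k) x) * vol g K x) = tri_integral m K (\<lambda>_. 0)" if "K \<in> triangles m" for K
    by (intro tri_integral_cong) (simp add: tri_gradient_const[OF assms that])
  then show ?thesis by (simp add: ip_grad_def tri_integral_def)
qed

section \<open>The volume density of a discrete metric on a triangle\<close>

lemma Sigma_pos_det_pos:
  assumes "g \<in> Sigma_pos m" and "K \<in> triangles m" and "x \<in> K"
  shows "0 < det (g K x)"
  using assms by (intro det_pos_2) (auto simp: Sigma_pos_def Sigma_space_def)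

lemma Sigma_h_component_span:
  assumes "triangular_mesh m" and "K \<in> triangles m" and "g \<in> Sigma_h m r"
  obtains c where "\<And>\<xi>. \<xi> \<in> tri_dom m K \<Longrightarrow>
    g K (emb m K \<xi>) $ i $ j = (\<Sum>\<alpha>\<in>mono_ix (int r). c \<alpha> * mono2 \<alpha> \<xi>)"
proof -
  have "poly_on_tri m K (int r) (\<lambda>x. g K x $ i $ j)"
    using assms unfolding Sigma_h_def poly_tensor_on_tri_def by blast
  from poly_on_tri_emb[OF assms(1,2) this] show thesis using that by blast
qed

text \<open>The determinant is quadratic in the entries, so products of two monomials span it. These
  products are the same for every \<open>g\<close>, hence for all times at once.\<close>

lemma Sigma_h_det_span:
  assumes "triangular_mesh m" and "K \<in> triangles m" and "g \<in> Sigma_h m r"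
  shows "\<exists>c. \<forall>\<xi>\<in>tri_dom m K. det (g K (emb m K \<xi>)) =
    (\<Sum>\<beta>\<in>mono_ix (int r) \<times> mono_ix (int r). c \<beta> * (mono2 (fst \<beta>) \<xi> * mono2 (snd \<beta>) \<xi>))"
proof -
  note span = Sigma_h_component_span[OF assms]
  obtain a where a: "\<And>\<xi>. \<xi> \<in> tri_dom m K \<Longrightarrow>
      g K (emb m K \<xi>) $ 1 $ 1 = (\<Sum>\<alpha>\<in>mono_ix (int r). a \<alpha> * mono2 \<alpha> \<xi>)"
    using span[where i = 1 and j = 1] by blast
  obtain b where b: "\<And>\<xi>. \<xi> \<in> tri_dom m K \<Longrightarrow>
      g K (emb m K \<xi>) $ 1 $ 2 = (\<Sum>\<alpha>\<in>mono_ix (int r). b \<alpha> * mono2 \<alpha> \<xi>)"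
    using span[where i = 1 and j = 2] by blast
  obtain c where c: "\<And>\<xi>. \<xi> \<in> tri_dom m K \<Longrightarrow>
      g K (emb m K \<xi>) $ 2 $ 1 = (\<Sum>\<alpha>\<in>mono_ix (int r). c \<alpha> * mono2 \<alpha> \<xi>)"
    using span[where i = 2 and j = 1] by blast
  obtain d where d: "\<And>\<xi>. \<xi> \<in> tri_dom m K \<Longrightarrow>
      g K (emb m K \<xi>) $ 2 $ 2 = (\<Sum>\<alpha>\<in>mono_ix (int r). d \<alpha> * mono2 \<alpha> \<xi>)"
    using span[where i = 2 and j = 2] by blast
  have "det (g K (emb m K \<xi>)) = (\<Sum>\<beta>\<in>mono_ix (int r) \<times> mono_ix (int r).
      (a (fst \<beta>) * d (snd \<beta>) - b (fst \<beta>) * c (snd \<beta>)) * (mono2 (fst \<beta>) \<xi> * mono2 (snd \<beta>) \<xi>))"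
    if "\<xi> \<in> tri_dom m K" for \<xi>
    using that
    by (simp add: det_2 a b c d sum_product sum.cartesian_product case_prod_beta
        flip: sum_subtractf) (simp add: algebra_simps)
  then show ?thesis by (intro exI ballI)
qed

lemma continuous_det_emb:
  assumes "triangular_mesh m" and "K \<in> triangles m" and "g \<in> Sigma_h m r"
  shows "continuous_on (tri_dom m K) (\<lambda>\<xi>. det (g K (emb m K \<xi>)))"
proof -
  obtain c where c: "\<And>\<xi>. \<xi> \<in> tri_dom m K \<Longrightarrow> det (g K (emb m K \<xi>)) =
      (\<Sum>\<beta>\<in>mono_ix (int r) \<times> mono_ix (int r). c \<beta> * (mono2 (fst \<beta>) \<xi> * mono2 (snd \<beta>) \<xi>))"
    using Sigma_h_det_span[OF assms] by blast
  show ?thesis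
    by (subst continuous_on_cong[OF refl c]) (auto intro!: continuous_intros continuous_mono2)
qed

text \<open>Integrability is what licenses splitting integrals linearly later on, since a
  non-integrable function has integral 0 by convention.\<close>

lemma integrable_tri_vol:
  assumes "triangular_mesh m" and "K \<in> triangles m" and "g \<in> Sigma_h m r" and "v \<in> V_h m q"
  shows "integrable (lebesgue_on (tri_dom m K)) (\<lambda>\<xi>. v (emb m K \<xi>) * vol g K (emb m K \<xi>))"
proof -
  have "continuous_on (carrier m) v" using assms(4) by (simp add: V_h_def)
  then have "continuous_on (tri_dom m K) (\<lambda>\<xi>. v (emb m K \<xi>))"
    by (rule continuous_on_compose2[OF _ continuous_emb])
      (use assms(2) in \<open>auto simp: tri_dom_def carrier_def\<close>)
  then show ?thesis
    unfolding vol_def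
    by (intro integrable_continuous_compact compact_tri_dom assms continuous_intros
        continuous_det_emb[OF assms(1-3)])
qed

section \<open>Conservation laws\<close>

text \<open>Covers the division by the area in the average curvature. A positive density with zero
  integral over a triangle vanishes almost everywhere there, so every integrand weighted by it
  integrates to 0; a mesh without triangles is included.\<close>

lemma mesh_integral_eq_0_of_area_eq_0:
  assumes m: "triangular_mesh m" and g: "g \<in> Sigma_pos m" and gh: "g \<in> Sigma_h m r"
    and area: "mesh_integral m g (\<lambda>_. 1) = 0"
  shows "mesh_integral m g u = 0"
proof -
  have fin: "finite (triangles m)"
    using m by (simp add: triangular_mesh_def triangulation_def)
  have nn: "0 \<le> tri_integral m K (\<lambda>x. 1 * vol g K x)" if "K \<in> triangles m" for K
    unfolding tri_integral_def
    by (intro Bochner_Integration.integral_nonneg)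
      (auto simp: vol_def tri_dom_def intro!: less_imp_le Sigma_pos_det_pos[OF g that])
  have "tri_integral m K (\<lambda>x. u x * vol g K x) = 0" if K: "K \<in> triangles m" for K
  proof -
    have *: "vol g K (emb m K \<xi>) > 0" if "\<xi> \<in> tri_dom m K" for \<xi>
      using that by (auto simp: vol_def tri_dom_def intro!: Sigma_pos_det_pos[OF g K])
    have "tri_integral m K (\<lambda>x. 1 * vol g K x) = 0"
      using area K
        sum_nonneg_eq_0_iff[of "triangles m" "\<lambda>K. tri_integral m K (\<lambda>x. 1 * vol g K x)", OF fin nn]
      unfolding mesh_integral_def by blast
    then have "AE \<xi> in lebesgue_on (tri_dom m K). vol g K (emb m K \<xi>) = 0"
      using integrable_tri_vol[OF m K gh const_in_V_h[of 1]]
      unfolding tri_integral_def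
      by (subst (asm) integral_nonneg_eq_0_iff_AE) (auto intro!: AE_I2 less_imp_le *)
    then show ?thesis
      unfolding tri_integral_def by (intro integral_eq_zero_AE) (auto elim: eventually_mono)
  qed
  then show ?thesis by (simp add: mesh_integral_def)
qed

text \<open>The factor 2 in the evolution of the metric cancels the 1/2 from differentiating the
  square root. The remaining trace of \<open>g^-1 \<rho>\<close> is the pairing of
  \<open>\<rho>\<close> with the metric itself, because the second inverse cancels against
  \<open>gh t\<close>.\<close>

lemma area_has_derivative:
  assumes m: "triangular_mesh m" and t: "t \<in> S"
    and gh: "\<And>s. s \<in> S \<Longrightarrow> gh s \<in> Sigma_h m r \<and> gh s \<in> Sigma_pos m"
    and der: "\<And>K x. K \<in> triangles m \<Longrightarrow> x \<in> K \<Longrightarrow>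
      ((\<lambda>s. gh s K x) has_vector_derivative - 2 *\<^sub>R \<rho> K x) (at t within S)"
  shows "((\<lambda>s. mesh_integral m (gh s) (\<lambda>_. 1)) has_real_derivative
    - ip_tensor m (gh t) \<rho> (gh t)) (at t within S)"
proof -
  have "((\<lambda>s. tri_integral m K (\<lambda>x. 1 * vol (gh s) K x)) has_real_derivative
      - ip_tensor_tri m (gh t) K (\<rho> K) (gh t K)) (at t within S)" if K: "K \<in> triangles m" for K
  proof -
    define D' where "D' \<xi> = (let A = gh t K (emb m K \<xi>); B = \<rho> K (emb m K \<xi>) in
      - 2 * (det A * trace (matrix_inv A ** B)))" for \<xi>
    have detpos: "0 < det (gh s K x)" if "s \<in> S" "x \<in> K" for s x
      using gh[OF that(1)] Sigma_pos_det_pos K that(2) by blast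
    have emb_in: "\<xi> \<in> tri_dom m K \<Longrightarrow> emb m K \<xi> \<in> K" for \<xi> by (simp add: tri_dom_def)
    have D': "((\<lambda>s. det (gh s K (emb m K \<xi>))) has_real_derivative D' \<xi>) (at t within S)"
      if "\<xi> \<in> tri_dom m K" for \<xi>
    proof -
      define x where "x = emb m K \<xi>"
      have x: "x \<in> K" using that by (simp add: tri_dom_def x_def)
      have c: "((\<lambda>s. gh s K x $ i $ j) has_real_derivative - 2 * \<rho> K x $ i $ j) (at t within S)" for i j
      proof -
        have "((\<lambda>s. gh s K x $ i $ j) has_vector_derivative (- 2 *\<^sub>R \<rho> K x) $ i $ j) (at t within S)"
          using bounded_linear.has_vector_derivative[OF bounded_linear_compose[OF
                bounded_linear_vec_nth bounded_linear_vec_nth] der[OF K x]] .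
        then show ?thesis by (simp add: has_real_derivative_iff_has_vector_derivative)
      qed
      have "det (gh t K x) \<noteq> 0" using detpos[OF t x] by simp
      from det_mult_trace_inv_2[OF this, of "\<rho> K x"] show ?thesis
        unfolding D'_def Let_def x_def[symmetric] unfolding det_2[of "gh _ K x"]
        by (auto intro!: derivative_eq_intros c simp: det_2 algebra_simps)
    qed
    have "((\<lambda>s. LINT \<xi>|lebesgue_on (tri_dom m K). sqrt (det (gh s K (emb m K \<xi>)))) has_real_derivative
        (LINT \<xi>|lebesgue_on (tri_dom m K). D' \<xi> / (2 * sqrt (det (gh t K (emb m K \<xi>)))))) (at t within S)"
      by (rule has_derivative_integral_sqrt[where I = "mono_ix (int r) \<times> mono_ix (int r)" and
            b = "\<lambda>\<beta> \<xi>. mono2 (fst \<beta>) \<xi> * mono2 (snd \<beta>) \<xi>"])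
        (auto intro!: compact_tri_dom[OF m K] finite_mono_ix continuous_intros continuous_mono2
          Sigma_h_det_span[OF m K] D' t detpos dest: gh emb_in)
    also have "(LINT \<xi>|lebesgue_on (tri_dom m K). D' \<xi> / (2 * sqrt (det (gh t K (emb m K \<xi>))))) =
        (LINT \<xi>|lebesgue_on (tri_dom m K). - (trace (matrix_inv (gh t K (emb m K \<xi>)) **
          \<rho> K (emb m K \<xi>) ** matrix_inv (gh t K (emb m K \<xi>)) ** gh t K (emb m K \<xi>)) *
          vol (gh t) K (emb m K \<xi>)))"
    proof (intro Bochner_Integration.integral_cong refl)
      fix \<xi> assume "\<xi> \<in> space (lebesgue_on (tri_dom m K))"
      then have d: "0 < det (gh t K (emb m K \<xi>))" using detpos[OF t] by (simp add: tri_dom_def)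
      have "d' * y / sqrt d' = y * sqrt d'" if "0 < d'" for d' y :: real
        using that by (simp add: field_simps)
      from this[OF d] d show "D' \<xi> / (2 * sqrt (det (gh t K (emb m K \<xi>)))) =
          - (trace (matrix_inv (gh t K (emb m K \<xi>)) **
          \<rho> K (emb m K \<xi>) ** matrix_inv (gh t K (emb m K \<xi>)) ** gh t K (emb m K \<xi>)) *
          vol (gh t) K (emb m K \<xi>))"
        by (simp add: D'_def Let_def vol_def matrix_inv_left_right flip: matrix_mul_assoc)
    qed
    finally show ?thesis
      by (simp add: tri_integral_def ip_tensor_tri_def vol_def)
  qed
  then show ?thesis
    unfolding mesh_integral_def ip_tensor_def
    by (auto intro!: derivative_eq_intros simp: sum_negf)
qed

text \<open>All factors of the metric cancel pointwise and leave \<open>u x - k\<close> times the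
  identity, whose trace in dimension two produces the factor 2.\<close>

lemma ip_tensor_scaled_metric:
  assumes m: "triangular_mesh m" and g: "g \<in> Sigma_pos m" "g \<in> Sigma_h m r" and u: "u \<in> V_h m q"
  shows "ip_tensor m g (\<lambda>K x. (u x - k) *\<^sub>R g K x) g =
    2 * (mesh_integral m g u - k * mesh_integral m g (\<lambda>_. 1))"
proof -
  have "ip_tensor_tri m g K (\<lambda>x. (u x - k) *\<^sub>R g K x) (g K) =
      2 * (tri_integral m K (\<lambda>x. u x * vol g K x) - k * tri_integral m K (\<lambda>x. 1 * vol g K x))"
    if K: "K \<in> triangles m" for K
  proof -
    have tr: "trace (matrix_inv (g K x) ** ((u x - k) *\<^sub>R g K x) ** matrix_inv (g K x) ** g K x) = 2 * (u x - k)"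
      if "x \<in> K" for x
    proof -
      have d: "det (g K x) \<noteq> 0" using Sigma_pos_det_pos[OF g(1) K that] by simp
      have "matrix_inv (g K x) ** ((u x - k) *\<^sub>R g K x) = (u x - k) *\<^sub>R mat 1"
        by (simp add: matrix_scalar_ac matrix_inv_left_right[OF d] flip: scalar_matrix_assoc)
      then show ?thesis
        by (simp add: matrix_inv_left_right[OF d] flip: matrix_mul_assoc)
          (simp add: trace_def sum_2 mat_def)
    qed
    have "ip_tensor_tri m g K (\<lambda>x. (u x - k) *\<^sub>R g K x) (g K) =
        tri_integral m K (\<lambda>x. 2 * (u x * vol g K x - k * (1 * vol g K x)))"
      unfolding ip_tensor_tri_def by (intro tri_integral_cong) (simp add: tr, simp add: algebra_simps)
    also have "\<dots> = 2 * (tri_integral m K (\<lambda>x. u x * vol g K x) - k * tri_integral m K (\<lambda>x. 1 * vol g K x))"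
      using integrable_tri_vol[OF m K g(2) u] integrable_tri_vol[OF m K g(2) const_in_V_h[of 1]]
      unfolding tri_integral_def by (simp add: Bochner_Integration.integral_diff)
    finally show ?thesis .
  qed
  then show ?thesis
    by (simp add: ip_tensor_def mesh_integral_def sum_subtractf sum_distrib_left
        right_diff_distrib mult.assoc)
qed

section \<open>Integration in time and the two conservation laws\<close>

lemma linear_ode_zero:
  fixes y :: "real \<Rightarrow> real"
  assumes "\<And>t. t \<in> {0..T} \<Longrightarrow> (y has_real_derivative c * y t) (at t within {0..T})"
    and "y 0 = 0" and "t \<in> {0..T}"
  shows "y t = 0"
proof -
  \<comment> \<open>The integrating factor \<open>exp (- c * t)\<close> turns the equation into a
    vanishing derivative on the interval.\<close>
  have "\<exists>k. \<forall>t\<in>{0..T}. y t * exp (- c * t) = k"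
    by (rule has_field_derivative_zero_constant)
      (auto intro!: derivative_eq_intros assms(1) simp: algebra_simps)
  then obtain k where k: "\<And>t. t \<in> {0..T} \<Longrightarrow> y t * exp (- c * t) = k" by blast
  have "0 \<in> {0..T}" using assms(3) by auto
  from k[OF this] k[OF assms(3)] assms(2) show ?thesis by simp
qed

text \<open>Stated for an arbitrary projection \<open>Q\<close> so as to serve both schemes: the
  argument rests on the curvature equation, where the gradient term vanishes for a constant test
  function.\<close>

lemma scheme_gauss_bonnet:
  assumes m: "triangular_mesh m" and sch: "scheme Q m r q M a T g \<kappa> gh \<kappa>h" and t: "t \<in> {0..T}"
  shows "mesh_integral m (gh t) (\<kappa>h t) = mesh_integral m (gh 0) (\<kappa>h 0)"
proof -
  have "((\<lambda>s. ip_fun m (gh s) (\<kappa>h s) (\<lambda>_. 1)) has_real_derivative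
      - ip_grad m (gh t) (\<kappa>h t) (\<lambda>_. 1)) (at t within {0..T})" if "t \<in> {0..T}" for t
    using sch const_in_V_h[of 1 m q] that unfolding scheme_def Let_def by blast
  then have "((\<lambda>s. mesh_integral m (gh s) (\<kappa>h s)) has_real_derivative 0) (at t within {0..T})"
    if "t \<in> {0..T}" for t
    using that by (simp add: ip_grad_const_right[OF m] ip_fun_def)
  then have "\<exists>k. \<forall>t\<in>{0..T}. mesh_integral m (gh t) (\<kappa>h t) = k"
    by (intro has_field_derivative_zero_constant) auto
  moreover have "0 \<in> {0..T}" using t by auto
  ultimately show ?thesis using t by metis
qed

lemma scheme_Pi_area:
  assumes m: "triangular_mesh m" and sch: "scheme_Pi m r q M a T g \<kappa> gh \<kappa>h" and t: "t \<in> {0..T}"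
  shows "mesh_integral m (gh t) (\<lambda>_. 1) = mesh_integral m (gh 0) (\<lambda>_. 1)"
proof -
  define A where "A s = mesh_integral m (gh s) (\<lambda>_. 1)" for s
  define k where "k = mesh_integral m (gh 0) (\<kappa>h 0) / A 0"
  note sch' = sch[unfolded scheme_Pi_def]
  have G: "mesh_integral m (gh t) (\<kappa>h t) = mesh_integral m (gh 0) (\<kappa>h 0)" if "t \<in> {0..T}" for t
    by (rule scheme_gauss_bonnet[OF m sch' that])
  have gh: "gh t \<in> Sigma_h m r \<and> gh t \<in> Sigma_pos m" and \<kappa>h: "\<kappa>h t \<in> V_h m q"
    and ev: "\<exists>\<rho>. Pi_proj m r (gh t) (\<lambda>K x. (\<kappa>h t x - k) *\<^sub>R gh t K x) \<rho> \<and>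
       (\<forall>K\<in>triangles m. \<forall>x\<in>K.
         ((\<lambda>s. gh s K x) has_vector_derivative - 2 *\<^sub>R \<rho> K x) (at t within {0..T}))"
    if "t \<in> {0..T}" for t
    using sch' that unfolding scheme_def Let_def k_def A_def by blast+
  have "0 \<in> {0..T}" using t by auto
  \<comment> \<open>The junk value \<open>k = 0\<close> for a vanishing area is covered as well.\<close>
  have G0: "mesh_integral m (gh 0) (\<kappa>h 0) = k * A 0"
    using mesh_integral_eq_0_of_area_eq_0[OF m, of "gh 0" r "\<kappa>h 0"] gh[OF \<open>0 \<in> {0..T}\<close>]
    by (auto simp: k_def A_def)
  have "(A has_real_derivative 2 * k * (A t - A 0)) (at t within {0..T})" if t: "t \<in> {0..T}" for t
  proof -
    obtain \<rho> where \<rho>: "Pi_proj m r (gh t) (\<lambda>K x. (\<kappa>h t x - k) *\<^sub>R gh t K x) \<rho>"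
      and der: "\<And>K x. K \<in> triangles m \<Longrightarrow> x \<in> K \<Longrightarrow>
         ((\<lambda>s. gh s K x) has_vector_derivative - 2 *\<^sub>R \<rho> K x) (at t within {0..T})"
      using ev[OF t] by blast
    \<comment> \<open>Here the choice of projection matters: \<open>Pi_proj\<close> tests against
      all of \<open>Sigma_h m r\<close>, which contains \<open>gh t\<close>, so the projected tensor
      may be replaced by the original one.\<close>
    have "ip_tensor m (gh t) \<rho> (gh t) = ip_tensor m (gh t) (\<lambda>K x. (\<kappa>h t x - k) *\<^sub>R gh t K x) (gh t)"
      using \<rho> gh[OF t] unfolding Pi_proj_def by blast
    also have "\<dots> = 2 * (k * A 0 - k * A t)"
      using ip_tensor_scaled_metric[OF m conjunct2[OF gh[OF t]] conjunct1[OF gh[OF t]] \<kappa>h[OF t], of k]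
        G[OF t] G0 by (simp add: A_def)
    finally have "- ip_tensor m (gh t) \<rho> (gh t) = 2 * k * (A t - A 0)" by (simp add: algebra_simps)
    then show ?thesis
      using area_has_derivative[OF m t gh der] unfolding A_def[symmetric] by simp
  qed
  \<comment> \<open>Subtracting the initial area makes the equation homogeneous, with rate
    \<open>2 * k\<close> and zero initial value.\<close>
  then have "((\<lambda>s. A s - A 0) has_real_derivative 2 * k * (A t - A 0)) (at t within {0..T})"
    if "t \<in> {0..T}" for t
    using that by (auto intro!: derivative_eq_intros)
  from linear_ode_zero[OF this _ t] show ?thesis by (simp add: A_def)
qed

theorem theorem3p3:
  fixes M :: "(real^3) set" and n :: "real^3 \<Rightarrow> real^3" and a :: "real^3 \<Rightarrow> real^3"
    and g :: "real \<Rightarrow> surf_tensor" and \<kappa> :: "real \<Rightarrow> real^3 \<Rightarrow> real"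
    and m :: mesh and C T :: real and r q :: nat
    and gh :: "real \<Rightarrow> mesh_tensor" and \<kappa>h :: "real \<Rightarrow> real^3 \<Rightarrow> real"
  assumes "smooth_surface M" and "outer_unit_normal M n"
    and "T > 0" and "normalized_ricci_flow T M g \<kappa>"
    and "triangular_mesh m" and "quasi_uniform C m" and "approximates m M n a"
    and "q \<ge> 1"
    and "scheme_P m r q M a T g \<kappa> gh \<kappa>h \<or> scheme_Pi m r q M a T g \<kappa> gh \<kappa>h"
  shows "(\<forall>t\<in>{0..T}. mesh_integral m (gh t) (\<kappa>h t) = mesh_integral m (gh 0) (\<kappa>h 0)) \<and>
         (scheme_Pi m r q M a T g \<kappa> gh \<kappa>h \<longrightarrow>
           (\<forall>t\<in>{0..T}. mesh_integral m (gh t) (\<lambda>_. 1) = mesh_integral m (gh 0) (\<lambda>_. 1)))"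
proof (intro conjI impI ballI)
  fix t assume "t \<in> {0..T}"
  then show "mesh_integral m (gh t) (\<kappa>h t) = mesh_integral m (gh 0) (\<kappa>h 0)"
    using assms(9) scheme_gauss_bonnet[OF assms(5)] unfolding scheme_P_def scheme_Pi_def by metis
next
  fix t assume "scheme_Pi m r q M a T g \<kappa> gh \<kappa>h" and "t \<in> {0..T}"
  then show "mesh_integral m (gh t) (\<lambda>_. 1) = mesh_integral m (gh 0) (\<lambda>_. 1)"
    by (rule scheme_Pi_area[OF assms(5)])
qed

end
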